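(* Let $\mathcal{A}$ be a unital $C^*$-algebra and let $\mathcal{F}\subseteq\mathcal{A}\cong B(\mathcal{A})$ be an ideal of finite type elements. Let $F\in B(\mathcal{A})$. Then $F\in\mathcal{M}\mathcal{K}\Phi_{+}(\mathcal{A})$ if and only if there exists a complementable submodule $M$ of $\mathcal{A}$ such that $F|_{M^{\perp}}$ is bounded below and $P_M\in\mathcal{F}$.
   Context: $\mathcal{A}$ is regarded as a right Hilbert module over itself and $B(\mathcal{A})$ is the $C^*$-algebra of all bounded $\mathcal{A}$-linear operators on $\mathcal{A}$ (all are adjointable). The map $a\mapsto L_a$ (left multiplication by $a$) is an isometric $*$-isomorphism $\mathcal{A}\to B(\mathcal{A})$, and $\mathcal{A}$ is identified with $B(\mathcal{A})$ through it; accordingly $\mathcal{F}$ is identified with its image in $B(\mathcal{A})$. Ideal of finite type elements: a subalgebra $\mathcal{F}\subseteq\mathcal{A}$ such that (i) $\mathcal{F}$ is a selfadjoint (two-sided) ideal in $\mathcal{A}$; (ii) there is an approximate unit $\{P_\alpha\}$ for $\mathcal{F}$, contained in $\mathcal{F}$, consisting of (orthogonal) projections; (iii) if $p,q\in\mathcal{F}$ are projections, then there exists $v\in\mathcal{A}$ such that $vv^*=q$ and $v^*v\perp p$, i.e. $v^*v+p$ is a projection as well. For closed submodules $M_1,M_2$ of a Hilbert module $M$, $M=M_1\tilde\oplus M_2$ means $M_1\cap M_2=\{0\}$ and $M_1+M_2=M$ (not necessarily orthogonal). A complementable submodule is a closed submodule which is a summand in such a decomposition. Every closed complementable submodule $M$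 of $\mathcal{A}$ is orthogonally complementable; $P_M$ denotes the orthogonal projection onto $M$. $F\in\mathcal{M}\mathcal{K}\Phi_+(\mathcal{A})$ means: there is a decomposition $\mathcal{A}=M_1\tilde\oplus N_1\stackrel{F}{\longrightarrow}M_2\tilde\oplus N_2=\mathcal{A}$ (closed submodules) with respect to which $F$ has the matrix $\begin{pmatrix}F_1&0\\0&F_4\end{pmatrix}$, where $F_1:M_1\to M_2$ is an isomorphism (bounded $\mathcal{A}$-linear bijection with bounded inverse) and $P_{N_1}\in\mathcal{F}$. $F|_{M^\perp}$ is bounded below if there is $c>0$ with $\|Fx\|\ge c\|x\|$ for all $x\in M^\perp$. *)

theory Defs
  imports "HOL-Analysis.Analysis"
begin

(* The unit comes from monoid_mult instead of ring_1, so that 0 = 1 (the zero algebra) is allowed. *)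
class unital_cstar_algebra = real_normed_algebra + banach + monoid_mult +
  fixes scaleC :: "complex \<Rightarrow> 'a \<Rightarrow> 'a" (infixr \<open>*\<^sub>C\<close> 75)
    and adj :: "'a \<Rightarrow> 'a"
  assumes scaleR_scaleC: "r *\<^sub>R x = complex_of_real r *\<^sub>C x"
    and scaleC_add_right: "c *\<^sub>C (x + y) = c *\<^sub>C x + c *\<^sub>C y"
    and scaleC_add_left: "(c + d) *\<^sub>C x = c *\<^sub>C x + d *\<^sub>C x"
    and scaleC_scaleC: "c *\<^sub>C (d *\<^sub>C x) = (c * d) *\<^sub>C x"
    and mult_scaleC_left: "(c *\<^sub>C x) * y = c *\<^sub>C (x * y)"
    and mult_scaleC_right: "x * (c *\<^sub>C y) = c *\<^sub>C (x * y)"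
    and norm_scaleC: "norm (c *\<^sub>C x) = cmod c * norm x"
    and adj_adj: "adj (adj x) = x"
    and adj_add: "adj (x + y) = adj x + adj y"
    and adj_scaleC: "adj (c *\<^sub>C x) = cnj c *\<^sub>C adj x"
    and adj_mult: "adj (x * y) = adj y * adj x"
    and cstar_identity: "norm (adj x * x) = norm x ^ 2"

instantiation complex :: unital_cstar_algebra
begin
definition scaleC_complex :: "complex \<Rightarrow> complex \<Rightarrow> complex" where
  "scaleC_complex c x = c * x"
definition adj_complex :: "complex \<Rightarrow> complex" where
  "adj_complex x = cnj x"
instance
  by standard
    (simp_all add: scaleC_complex_def adj_complex_def scaleR_conv_of_real algebra_simps
      norm_mult power2_eq_square)
end

definition is_projection :: "'a::unital_cstar_algebra \<Rightarrow> bool" where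
  "is_projection p \<longleftrightarrow> p * p = p \<and> adj p = p"

definition selfadjoint_ideal :: "'a::unital_cstar_algebra set \<Rightarrow> bool" where
  "selfadjoint_ideal I \<longleftrightarrow>
     0 \<in> I \<and> (\<forall>x\<in>I. \<forall>y\<in>I. x + y \<in> I) \<and> (\<forall>c. \<forall>x\<in>I. c *\<^sub>C x \<in> I) \<and>
     (\<forall>a. \<forall>x\<in>I. a * x \<in> I \<and> x * a \<in> I) \<and> (\<forall>x\<in>I. adj x \<in> I)"

(* The net is encoded by its filter of tails, pushed forward to the algebra: a net in S yields
   such a filter, and every such filter arises from a net. The net need not be increasing. *)
definition approx_unit_filter :: "'a::unital_cstar_algebra set \<Rightarrow> 'a filter \<Rightarrow> bool" where
  "approx_unit_filter S G \<longleftrightarrow>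
     G \<noteq> bot \<and> (\<forall>\<^sub>F p in G. p \<in> S) \<and>
     (\<forall>a\<in>S. ((\<lambda>p. p * a) \<longlongrightarrow> a) G \<and> ((\<lambda>p. a * p) \<longlongrightarrow> a) G)"

(* The ideal is not required to be norm closed. *)
definition finite_type_ideal :: "'a::unital_cstar_algebra set \<Rightarrow> bool" where
  "finite_type_ideal I \<longleftrightarrow>
     selfadjoint_ideal I \<and>
     (\<exists>G. approx_unit_filter I G \<and> (\<forall>\<^sub>F p in G. is_projection p)) \<and>
     (\<forall>p\<in>I. \<forall>q\<in>I. is_projection p \<longrightarrow> is_projection q \<longrightarrow>
        (\<exists>v. v * adj v = q \<and> is_projection (adj v * v + p)))"

(* The algebra as a right Hilbert module over itself, with inner product adj x * y; by the
   C*-identity the module norm is the algebra norm. As the algebra is unital, right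
   multiplication by c *\<^sub>C 1 shows that submodules are complex subspaces and that additive
   module maps are complex linear. *)
definition closed_submodule :: "'a::unital_cstar_algebra set \<Rightarrow> bool" where
  "closed_submodule M \<longleftrightarrow>
     closed M \<and> 0 \<in> M \<and> (\<forall>x\<in>M. \<forall>y\<in>M. x + y \<in> M) \<and> (\<forall>x\<in>M. \<forall>a. x * a \<in> M)"

definition bounded_module_map ::
    "'a::unital_cstar_algebra set \<Rightarrow> 'a set \<Rightarrow> ('a \<Rightarrow> 'a) \<Rightarrow> bool" where
  "bounded_module_map M N T \<longleftrightarrow>
     T ` M \<subseteq> N \<and> (\<forall>x\<in>M. \<forall>y\<in>M. T (x + y) = T x + T y) \<and>
     (\<forall>x\<in>M. \<forall>a. T (x * a) = T x * a) \<and> (\<exists>K. \<forall>x\<in>M. norm (T x) \<le> K * norm x)"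

definition bounded_operators :: "('a::unital_cstar_algebra \<Rightarrow> 'a) set" where
  "bounded_operators = {T. bounded_module_map UNIV UNIV T}"

definition module_iso ::
    "'a::unital_cstar_algebra set \<Rightarrow> 'a set \<Rightarrow> ('a \<Rightarrow> 'a) \<Rightarrow> bool" where
  "module_iso M N T \<longleftrightarrow>
     bounded_module_map M N T \<and> bij_betw T M N \<and> bounded_module_map N M (inv_into M T)"

definition lmult :: "'a::unital_cstar_algebra \<Rightarrow> 'a \<Rightarrow> 'a" where
  "lmult a = (\<lambda>x. a * x)"

(* The (not necessarily orthogonal) decomposition of the whole algebra as M + N. *)
definition decomposition :: "'a::unital_cstar_algebra set \<Rightarrow> 'a set \<Rightarrow> bool" where
  "decomposition M N \<longleftrightarrow>
     closed_submodule M \<and> closed_submodule N \<and> M \<inter> N = {0} \<and>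
     {x + y |x y. x \<in> M \<and> y \<in> N} = UNIV"

definition complementable :: "'a::unital_cstar_algebra set \<Rightarrow> bool" where
  "complementable M \<longleftrightarrow> (\<exists>N. decomposition M N)"

definition orth_compl :: "'a::unital_cstar_algebra set \<Rightarrow> 'a set" where
  "orth_compl M = {x. \<forall>y\<in>M. adj y * x = 0}"

(* Projection onto M along N; meaningful if the algebra is the direct sum of M and N. *)
definition proj_along :: "'a::unital_cstar_algebra set \<Rightarrow> 'a set \<Rightarrow> 'a \<Rightarrow> 'a" where
  "proj_along M N x = (THE y. y \<in> M \<and> x - y \<in> N)"

(* Only used for complementable M; these are orthogonally complementable, so the
   definite description is then well defined. *)
definition orth_proj :: "'a::unital_cstar_algebra set \<Rightarrow> 'a \<Rightarrow> 'a" where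
  "orth_proj M = proj_along M (orth_compl M)"

(* The entries of the matrix of F with respect to M1 + N1 and M2 + N2 are the compositions of F,
   restricted to M1 or N1, with the projections of M2 + N2 onto its summands. *)
definition MKPhi_plus :: "'a::unital_cstar_algebra set \<Rightarrow> ('a \<Rightarrow> 'a) set" where
  "MKPhi_plus I = {F \<in> bounded_operators. \<exists>M1 N1 M2 N2.
     decomposition M1 N1 \<and> decomposition M2 N2 \<and>
     (\<forall>x\<in>N1. proj_along M2 N2 (F x) = 0) \<and>
     (\<forall>x\<in>M1. proj_along N2 M2 (F x) = 0) \<and>
     module_iso M1 M2 (\<lambda>x. proj_along M2 N2 (F x)) \<and>
     orth_proj N1 \<in> lmult ` I}"

definition bounded_below_on :: "'a::unital_cstar_algebra set \<Rightarrow> ('a \<Rightarrow> 'a) \<Rightarrow> bool" where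
  "bounded_below_on S F \<longleftrightarrow> (\<exists>c>0. \<forall>x\<in>S. norm (F x) \<ge> c * norm x)"

end

theory Submission
  imports Defs
begin

text \<open>A bounded module map on the algebra is left multiplication by some \<open>f\<close>, and every
  complementable submodule is the range of left multiplication by an idempotent, hence also by
  a projection. Both directions thus become computations with algebra elements.

  If \<open>f\<close> is diagonal with respect to decompositions with summands \<open>M1\<close>, \<open>N1\<close> and \<open>M2\<close>, \<open>N2\<close>
  and invertible from \<open>M1\<close> to \<open>M2\<close>, then \<open>N1\<close> itself is the required submodule: a vector \<open>x\<close>
  orthogonal to \<open>N1\<close> is the orthogonal projection of its \<open>M1\<close>-component, whose norm is
  controlled by that of \<open>f * x\<close>.

  Conversely, let \<open>f\<close> be bounded below on the orthogonal complement of the range of a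
  projection \<open>p\<close> in the ideal. Then \<open>f\<close> has a bounded left inverse there, its image is
  complemented, and with respect to this splitting \<open>f\<close> is block upper triangular with
  invertible upper corner. One step of Gaussian elimination clears the off-diagonal entry and
  replaces the range of \<open>p\<close> by that of an idempotent \<open>e\<close> with \<open>e = e * p\<close>. This \<open>e\<close> lies in
  the ideal, and so does its range projection.

  Two facts from \<open>C*\<close>-theory carry the argument: an idempotent has a range projection which
  is a right multiple of it (\<open>idempotent_range_projection\<close>), and a selfadjoint element that is
  bounded below is invertible (\<open>selfadjoint_bounded_below_has_inverse\<close>). Both follow from the
  invertibility of \<open>s + k\<close> for \<open>s > 0\<close> and skew-adjoint \<open>k\<close>.\<close>

section \<open>Involution and norm\<close>

lemma adj_zero [simp]: "adj (0::'a::unital_cstar_algebra) = 0"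
  using adj_add[of "0::'a" 0] by simp

lemma adj_minus: "adj (- x) = - adj (x::'a::unital_cstar_algebra)"
  using adj_add[of x "- x"] by (simp add: eq_neg_iff_add_eq_0 add.commute)

lemma adj_diff: "adj (x - y) = adj x - adj (y::'a::unital_cstar_algebra)"
  using adj_add[of x "- y"] by (simp add: adj_minus)

lemma adj_one [simp]: "adj (1::'a::unital_cstar_algebra) = 1"
  using adj_mult[of "adj 1" "1::'a"] by (simp add: adj_adj)

lemma adj_scaleR: "adj (r *\<^sub>R x) = r *\<^sub>R adj (x::'a::unital_cstar_algebra)"
  by (simp add: scaleR_scaleC adj_scaleC)

lemma norm_adj_le: "norm x \<le> norm (adj (x::'a::unital_cstar_algebra))"
proof (cases "x = 0")
  case False
  have "norm x * norm x \<le> norm (adj x) * norm x"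
    using norm_mult_ineq[of "adj x" x] by (simp add: cstar_identity power2_eq_square)
  then show ?thesis using False by simp
qed simp

lemma norm_adj: "norm (adj x) = norm (x::'a::unital_cstar_algebra)"
  using norm_adj_le[of x] norm_adj_le[of "adj x"] by (simp add: adj_adj)

lemma norm_projection_le_1:
  assumes "is_projection (p::'a::unital_cstar_algebra)"
  shows "norm p \<le> 1"
proof -
  have "norm p = norm p ^ 2"
    using cstar_identity[of p] assms by (simp add: is_projection_def)
  then show ?thesis by (auto simp: power2_eq_square)
qed

lemma norm_projection_mult_le:
  assumes "is_projection (p::'a::unital_cstar_algebra)"
  shows "norm (p * x) \<le> norm x"
  using norm_mult_ineq[of p x] mult_right_mono[OF norm_projection_le_1[OF assms], of "norm x"]
  by simp

lemma is_projection_one_minus: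
  "is_projection p \<Longrightarrow> is_projection (1 - p :: 'a::unital_cstar_algebra)"
  by (simp add: is_projection_def adj_diff algebra_simps)

section \<open>Invertible elements\<close>

definition has_inverse :: "'a::unital_cstar_algebra \<Rightarrow> bool" where
  "has_inverse a \<longleftrightarrow> (\<exists>b. a * b = 1 \<and> b * a = 1)"

lemma has_inverseI:
  assumes "a * b = 1" "c * a = (1::'a::unital_cstar_algebra)"
  shows "has_inverse a"
proof -
  have "c = c * (a * b)" using assms(1) by simp
  also have "\<dots> = b" using assms(2) by (simp add: mult.assoc[symmetric])
  finally show ?thesis using assms unfolding has_inverse_def by blast
qed

lemma has_inverse_mult:
  assumes "has_inverse a" "has_inverse (b::'a::unital_cstar_algebra)"
  shows "has_inverse (a * b)"
proof -
  obtain a' b' where "a * a' = 1" "a' * a = 1" "b * b' = 1" "b' * b = 1"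
    using assms unfolding has_inverse_def by blast
  then have "(a * b) * (b' * a') = 1" "(b' * a') * (a * b) = 1"
    by (metis mult.assoc mult_1_left)+
  then show ?thesis by (rule has_inverseI)
qed

lemma has_inverse_scaleC_iff:
  assumes "c \<noteq> 0"
  shows "has_inverse (c *\<^sub>C (a::'a::unital_cstar_algebra)) \<longleftrightarrow> has_inverse a"
proof -
  have one: "1 *\<^sub>C x = x" for x :: 'a
    using scaleR_scaleC[of 1 x] by simp
  have imp: "has_inverse (d *\<^sub>C x)" if d: "d \<noteq> 0" and x: "has_inverse x" for d and x :: 'a
  proof -
    obtain b where "x * b = 1" "b * x = 1" using x unfolding has_inverse_def by blast
    then show ?thesis using d
      by (intro has_inverseI[of _ "inverse d *\<^sub>C b" "inverse d *\<^sub>C b"])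
        (simp_all add: mult_scaleC_left mult_scaleC_right scaleC_scaleC one)
  qed
  from imp[of c a] imp[of "inverse c" "c *\<^sub>C a"] assms show ?thesis
    by (auto simp: scaleC_scaleC one)
qed

text \<open>The Neumann series in disguise: a right inverse of \<open>1 - a\<close> is a fixed point of the
  contraction \<open>x \<mapsto> 1 + a * x\<close>, and symmetrically for a left inverse.\<close>

lemma has_inverse_one_minus:
  assumes "norm (a::'a::unital_cstar_algebra) < 1"
  shows "has_inverse (1 - a)"
proof -
  have fixpoint: "\<exists>x. T x = x"
    if "\<And>x y. norm (T x - T y) \<le> norm a * norm (x - y)" for T :: "'a \<Rightarrow> 'a"
    using banach_fix_type[of "norm a" T] that assms by (auto simp: dist_norm)
  have "\<exists>x. 1 + a * x = x"
    by (rule fixpoint) (simp add: right_diff_distrib[symmetric] norm_mult_ineq)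
  moreover have "norm ((x - y) * a) \<le> norm a * norm (x - y)" for x y
    using norm_mult_ineq[of "x - y" a] by (simp add: mult.commute)
  then have "\<exists>x. 1 + x * a = x"
    by (intro fixpoint) (simp add: left_diff_distrib[symmetric])
  ultimately obtain x y where "1 + a * x = x" "1 + y * a = y" by blast
  then show ?thesis
    by (intro has_inverseI[of _ x y]) (simp_all add: left_diff_distrib right_diff_distrib diff_eq_eq)
qed

lemma has_inverse_scalar_minus:
  assumes "norm (a::'a::unital_cstar_algebra) < s"
  shows "has_inverse (s *\<^sub>R 1 - a)"
proof -
  have s: "s > 0" using assms norm_ge_zero[of a] by linarith
  have "norm ((1 / s) *\<^sub>R a) < 1" using assms s by simp
  from has_inverse_one_minus[OF this] have "has_inverse (complex_of_real s *\<^sub>C (1 - (1 / s) *\<^sub>R a))"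
    using s by (simp add: has_inverse_scaleC_iff)
  then show ?thesis using s
    by (simp add: scaleR_scaleC[symmetric] scaleR_diff_right)
qed

text \<open>The spectrum of a skew-adjoint element is purely imaginary. The \<open>C*\<close>-identity gives
  \<open>norm (t - k)\<^sup>2 \<le> t\<^sup>2 + norm k\<^sup>2\<close>, which is smaller than \<open>(s + t)\<^sup>2\<close> for large \<open>t\<close>;
  hence \<open>s + k = (s + t) - (t - k)\<close> is invertible.\<close>

lemma has_inverse_scalar_plus_skew:
  assumes k: "adj k = - (k::'a::unital_cstar_algebra)" and s: "s > 0"
  shows "has_inverse (s *\<^sub>R 1 + k)"
proof -
  define t where "t = (norm k)\<^sup>2 / s"
  have t: "t \<ge> 0" "s * t = (norm k)\<^sup>2" using s by (simp_all add: t_def)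
  have "(norm (t *\<^sub>R 1 - k))\<^sup>2 = norm ((t * t) *\<^sub>R 1 - k * k)"
    by (simp add: cstar_identity[symmetric] adj_diff adj_scaleR k algebra_simps)
  also have "\<dots> \<le> t * t * norm (1::'a) + norm (k * k)"
    using norm_triangle_ineq4[of "(t * t) *\<^sub>R 1" "k * k"] by simp
  also have "\<dots> \<le> t\<^sup>2 + (norm k)\<^sup>2"
    using mult_left_mono[OF norm_projection_le_1[of "1::'a"], of "t * t"] norm_mult_ineq[of k k]
    by (simp add: is_projection_def power2_eq_square)
  also have "\<dots> = t\<^sup>2 + s * t" by (simp add: t(2))
  also have "\<dots> < (s + t)\<^sup>2"
    using s t(1) by (simp add: power2_sum add_nonneg_pos)
  finally have "norm (t *\<^sub>R 1 - k) < s + t"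
    using s t(1) by (meson add_nonneg_nonneg less_imp_le power_less_imp_less_base)
  from has_inverse_scalar_minus[OF this] show ?thesis
    by (simp add: scaleR_add_left)
qed

text \<open>If \<open>k\<close> is bounded below by \<open>c\<close>, then the inverses of \<open>s + k\<close> are bounded by
  \<open>1 / (c - s)\<close>, so that already \<open>s = c / 3\<close> makes \<open>k\<close> a small perturbation of \<open>s + k\<close>.\<close>

lemma skew_bounded_below_has_inverse:
  assumes k: "adj k = - (k::'a::unital_cstar_algebra)"
    and c: "c > 0" "\<And>x. norm (k * x) \<ge> c * norm x"
  shows "has_inverse k"
proof -
  define s where "s = c / 3"
  have s: "s > 0" using c by (simp add: s_def)
  obtain b where b: "(s *\<^sub>R 1 + k) * b = 1" "b * (s *\<^sub>R 1 + k) = 1"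
    using has_inverse_scalar_plus_skew[OF k s] unfolding has_inverse_def by blast
  have kb: "k * b = 1 - s *\<^sub>R b" using b(1) by (simp add: algebra_simps eq_diff_eq)
  have "c * norm b \<le> norm (1 - s *\<^sub>R b)" using c(2)[of b] kb by simp
  also have "\<dots> \<le> 1 + s * norm b"
    using norm_triangle_ineq4[of 1 "s *\<^sub>R b"] norm_projection_le_1[of "1::'a"] s
    by (simp add: is_projection_def)
  finally have "norm (s *\<^sub>R b) < 1" using s by (simp add: s_def)
  then have "has_inverse (1 - s *\<^sub>R b)" by (rule has_inverse_one_minus)
  moreover have "has_inverse (s *\<^sub>R 1 + k)" using s k by (rule has_inverse_scalar_plus_skew[rotated])
  ultimately have "has_inverse ((1 - s *\<^sub>R b) * (s *\<^sub>R 1 + k))" by (rule has_inverse_mult)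
  also have "(1 - s *\<^sub>R b) * (s *\<^sub>R 1 + k) = k"
    using b(2) by (simp add: left_diff_distrib)
  finally show ?thesis .
qed

lemma selfadjoint_bounded_below_has_inverse:
  assumes h: "adj h = (h::'a::unital_cstar_algebra)"
    and c: "c > 0" "\<And>x. norm (h * x) \<ge> c * norm x"
  shows "has_inverse h"
proof -
  have neg: "(- \<i>) *\<^sub>C x = - (\<i> *\<^sub>C x)" for x :: 'a
    using scaleC_add_left[of "- \<i>" \<i> x] scaleR_scaleC[of 0 x]
    by (simp add: eq_neg_iff_add_eq_0)
  have "has_inverse (\<i> *\<^sub>C h)"
    using c by (intro skew_bounded_below_has_inverse)
      (auto simp: adj_scaleC h neg mult_scaleC_left norm_scaleC)
  then show ?thesis by (simp add: has_inverse_scaleC_iff)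
qed

section \<open>Idempotents and their range projections\<close>

text \<open>With \<open>s = e + adj e - 1\<close> and the skew-adjoint \<open>k = e - adj e\<close> one has
  \<open>s * s = (1 + k) * (1 - k)\<close>, so \<open>s\<close> is invertible. Since \<open>s\<close> intertwines \<open>e\<close> and \<open>adj e\<close>,
  the element \<open>e * s\<^sup>-\<^sup>1\<close> is selfadjoint; it is the range projection. As a multiple of \<open>e\<close> it stays
  in every ideal that contains \<open>e\<close>.\<close>

lemma idempotent_range_projection:
  assumes e: "e * e = (e::'a::unital_cstar_algebra)"
  obtains b where "is_projection (e * b)" "(e * b) * e = e"
proof -
  define s where "s = e + adj e - 1"
  have e': "adj e * adj e = adj e" using e by (metis adj_mult)
  define k where "k = e - adj e"
  have k: "adj k = - k" "adj (- k) = - (- k)" by (simp_all add: k_def adj_diff adj_minus adj_adj)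
  have "has_inverse (1 + k)" "has_inverse (1 - k)"
    using has_inverse_scalar_plus_skew[OF k(1), of 1] has_inverse_scalar_plus_skew[OF k(2), of 1]
    by simp_all
  then have "has_inverse ((1 + k) * (1 - k))" by (rule has_inverse_mult)
  also have "(1 + k) * (1 - k) = s * s"
    by (simp add: s_def k_def algebra_simps e e')
  finally obtain y where y: "s * s * y = 1" "y * (s * s) = 1" unfolding has_inverse_def by blast
  then have "has_inverse s"
    by (intro has_inverseI[of _ "s * y" "y * s"]) (simp_all add: mult.assoc)
  then obtain b where b: "s * b = 1" "b * s = 1" unfolding has_inverse_def by blast
  have es: "e * s = e * adj e" "s * e = adj e * e" "s * adj e = e * adj e" "adj e * s = adj e * e"
    by (simp_all add: s_def algebra_simps e e')
  have s: "adj s = s" by (simp add: s_def adj_diff adj_add adj_adj add.commute)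
  have "adj b * s = 1" using b(1) s by (metis adj_mult adj_one)
  then have ab: "adj b = b" using b(1) by (metis mult.assoc mult_1_left mult_1_right)
  have be: "b * e = adj e * b"
    using es(1,3) b by (metis mult.assoc mult_1_left mult_1_right)
  have eb: "e * b = b * adj e"
    using es(2,4) b by (metis mult.assoc mult_1_left mult_1_right)
  have pe: "(e * b) * e = e"
  proof -
    have "(e * b) * e = e * adj e * b" by (simp add: be mult.assoc)
    also have "\<dots> = e * (s * b)" by (simp add: es(1)[symmetric] mult.assoc)
    finally show ?thesis by (simp add: b(1))
  qed
  have "is_projection (e * b)"
    unfolding is_projection_def
  proof
    show "e * b * (e * b) = e * b" using pe by (simp add: mult.assoc[symmetric])
    show "adj (e * b) = e * b" using ab eb by (metis adj_mult)
  qed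
  then show thesis using pe by (rule that)
qed

section \<open>Complementable submodules\<close>

text \<open>For idempotent \<open>e\<close> this is the right ideal generated by \<open>e\<close>; written as an equalizer, it is
  visibly closed.\<close>

definition fixed_by :: "'a::unital_cstar_algebra \<Rightarrow> 'a set" where
  "fixed_by e = {x. e * x = x}"

lemma mem_fixed_by_iff: "x \<in> fixed_by e \<longleftrightarrow> e * x = x"
  by (simp add: fixed_by_def)

lemma fixed_by_eqI:
  assumes "e * p = p" "p * e = (e::'a::unital_cstar_algebra)"
  shows "fixed_by e = fixed_by p"
  unfolding fixed_by_def
  by (metis assms mult.assoc)

lemma closed_submodule_fixed_by: "closed_submodule (fixed_by (e::'a::unital_cstar_algebra))"
proof -
  have "closed {x. e * x = x}"
    by (intro closed_Collect_eq continuous_intros)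
  then show ?thesis
    by (auto simp: closed_submodule_def fixed_by_def algebra_simps mult.assoc[symmetric])
qed

lemma decomposition_fixed_by:
  assumes "e * e = (e::'a::unital_cstar_algebra)"
  shows "decomposition (fixed_by e) (fixed_by (1 - e))"
proof -
  have "\<exists>x y. z = x + y \<and> x \<in> fixed_by e \<and> y \<in> fixed_by (1 - e)" for z
    by (rule exI[of _ "e * z"], rule exI[of _ "z - e * z"])
      (simp add: fixed_by_def algebra_simps mult.assoc[symmetric] assms)
  then show ?thesis
    unfolding decomposition_def
    by (auto simp: closed_submodule_fixed_by) (auto simp: fixed_by_def algebra_simps)
qed

lemma proj_along_fixed_by:
  assumes "e * e = (e::'a::unital_cstar_algebra)"
  shows "proj_along (fixed_by e) (fixed_by (1 - e)) = lmult e"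
proof
  fix x
  show "proj_along (fixed_by e) (fixed_by (1 - e)) x = lmult e x"
    unfolding proj_along_def lmult_def fixed_by_def
    by (rule the_equality) (auto simp: algebra_simps mult.assoc[symmetric] assms)
qed

lemma decomposition_commute: "decomposition M N \<longleftrightarrow> decomposition N M"
  unfolding decomposition_def by (auto simp: Int_commute add.commute set_eq_iff) (metis add.commute)+

text \<open>Splitting \<open>1\<close> as \<open>e + (1 - e)\<close> along a decomposition yields its idempotent: every \<open>x\<close>
  then splits as \<open>e * x + (1 - e) * x\<close>.\<close>

lemma decomposition_idempotent:
  assumes "decomposition M (N::'a::unital_cstar_algebra set)"
  obtains e where "e * e = e" "M = fixed_by e" "N = fixed_by (1 - e)"
proof -
  have cl: "closed_submodule M" "closed_submodule N" and int: "M \<inter> N = {0}"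
    and sum: "{x + y |x y. x \<in> M \<and> y \<in> N} = UNIV"
    using assms by (auto simp: decomposition_def)
  obtain e n where en: "1 = e + n" "e \<in> M" "n \<in> N" using sum by blast
  have n: "n = 1 - e" using en(1) by (simp add: algebra_simps)
  have M: "e * x \<in> M" and N: "(1 - e) * x \<in> N" for x
    using cl en n by (auto simp: closed_submodule_def)
  have diff: "x - y \<in> A" if "closed_submodule A" "x \<in> A" "y \<in> A" for x y and A :: "'a set"
  proof -
    have "x + y * (- 1) \<in> A" using that unfolding closed_submodule_def by blast
    then show ?thesis by simp
  qed
  have M': "e * x = x" if "x \<in> M" for x
  proof -
    have "x - e * x \<in> M" using diff[OF cl(1) that M] .
    moreover have "x - e * x \<in> N" using N[of x] by (simp add: algebra_simps)
    ultimately have "x - e * x = 0" using int by blast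
    then show ?thesis by simp
  qed
  have N': "e * x = 0" if "x \<in> N" for x
  proof -
    have "x - (1 - e) * x \<in> N" using diff[OF cl(2) that N] .
    then have "e * x \<in> N" by (simp add: algebra_simps)
    with M[of x] int show ?thesis by blast
  qed
  show thesis
  proof
    show "e * e = e" using M' en(2) .
    have "x \<in> M \<longleftrightarrow> e * x = x" for x using M' M by metis
    then show "M = fixed_by e" by (auto simp: fixed_by_def)
    have "x \<in> N \<longleftrightarrow> (1 - e) * x = x" for x
      using N' N by (metis diff_zero left_diff_distrib mult_1_left)
    then show "N = fixed_by (1 - e)" by (auto simp: fixed_by_def)
  qed
qed

lemma complementable_projection:
  assumes "complementable (M::'a::unital_cstar_algebra set)"
  obtains p where "is_projection p" "M = fixed_by p"
proof -
  obtain e where e: "e * e = e" "M = fixed_by e"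
    using assms decomposition_idempotent unfolding complementable_def by metis
  obtain b where b: "is_projection (e * b)" "(e * b) * e = e"
    using idempotent_range_projection[OF e(1)] .
  have "fixed_by e = fixed_by (e * b)"
    by (rule fixed_by_eqI) (simp_all add: b(2) mult.assoc[symmetric] e(1))
  with b e show thesis using that by blast
qed

lemma orth_compl_fixed_by:
  assumes "is_projection (p::'a::unital_cstar_algebra)"
  shows "orth_compl (fixed_by p) = fixed_by (1 - p)"
proof -
  have p: "p * p = p" "adj p = p" using assms by (auto simp: is_projection_def)
  have "adj y * x = 0" if "p * x = 0" "p * y = y" for x y
    using that p by (metis adj_mult mult.assoc mult_zero_right)
  moreover have "p * x = 0" if "\<forall>y. p * y = y \<longrightarrow> adj y * x = 0" for x
    using that p by metis
  ultimately have "(\<forall>y. p * y = y \<longrightarrow> adj y * x = 0) \<longleftrightarrow> p * x = 0" for x by blast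
  then show ?thesis by (simp add: orth_compl_def fixed_by_def left_diff_distrib)
qed

lemma orth_proj_fixed_by:
  assumes "is_projection (p::'a::unital_cstar_algebra)"
  shows "orth_proj (fixed_by p) = lmult p"
  using assms
  by (simp add: orth_proj_def orth_compl_fixed_by proj_along_fixed_by is_projection_def)

lemma orth_proj_in_lmult_iff:
  assumes "is_projection (p::'a::unital_cstar_algebra)"
  shows "orth_proj (fixed_by p) \<in> lmult ` I \<longleftrightarrow> p \<in> I"
proof -
  have "inj (lmult :: 'a \<Rightarrow> _)" by (rule injI) (metis lmult_def mult_1_right)
  then show ?thesis by (simp add: orth_proj_fixed_by assms inj_image_mem_iff)
qed

lemma bounded_operator_eq_lmult:
  assumes "F \<in> bounded_operators"
  shows "F = lmult (F (1::'a::unital_cstar_algebra))"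
proof
  fix x
  have "F (1 * x) = F 1 * x"
    using assms unfolding bounded_operators_def bounded_module_map_def by blast
  then show "F x = lmult (F 1) x" by (simp add: lmult_def)
qed

lemma bounded_module_map_lmult:
  assumes "\<And>x. x \<in> M \<Longrightarrow> T x = a * (x::'a::unital_cstar_algebra)"
    and "\<And>x. x \<in> M \<Longrightarrow> a * x \<in> N" and "closed_submodule M"
  shows "bounded_module_map M N T"
proof -
  have "\<forall>x\<in>M. norm (T x) \<le> norm a * norm x" using assms(1) norm_mult_ineq by metis
  moreover have "x + y \<in> M" "x * z \<in> M" if "x \<in> M" "y \<in> M" for x y z
    using that assms(3) by (auto simp: closed_submodule_def)
  ultimately show ?thesis
    using assms(1,2) unfolding bounded_module_map_def
    by (auto simp: distrib_left mult.assoc)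
qed

lemma module_iso_lmult:
  assumes T: "\<And>x. x \<in> M \<Longrightarrow> T x = a * (x::'a::unital_cstar_algebra)"
    and a: "\<And>x. x \<in> M \<Longrightarrow> a * x \<in> N" and b: "\<And>y. y \<in> N \<Longrightarrow> b * y \<in> M"
    and ba: "\<And>x. x \<in> M \<Longrightarrow> b * (a * x) = x" and ab: "\<And>y. y \<in> N \<Longrightarrow> a * (b * y) = y"
    and MN: "closed_submodule M" "closed_submodule N"
  shows "module_iso M N T"
proof -
  have bij: "bij_betw T M N"
    by (rule bij_betwI[where g = "\<lambda>y. b * y"]) (auto simp: T a b ba ab)
  have "inv_into M T y = b * y" if "y \<in> N" for y
    using that bij b ab T by (intro inv_into_f_eq) (auto simp: bij_betw_def)
  then show ?thesis
    unfolding module_iso_def using bij T a b MN by (blast intro: bounded_module_map_lmult)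
qed

section \<open>The characterization\<close>

lemma MKPhi_plus_imp_bounded_below:
  assumes "F \<in> MKPhi_plus (I::'a::unital_cstar_algebra set)"
  shows "\<exists>M. complementable M \<and> bounded_below_on (orth_compl M) F \<and> orth_proj M \<in> lmult ` I"
proof -
  obtain M1 N1 M2 N2 where F: "F \<in> bounded_operators"
    and d1: "decomposition M1 N1" and d2: "decomposition M2 N2"
    and N1: "\<forall>x\<in>N1. proj_along M2 N2 (F x) = 0"
    and iso: "module_iso M1 M2 (\<lambda>x. proj_along M2 N2 (F x))"
    and q: "orth_proj N1 \<in> lmult ` I"
    using assms unfolding MKPhi_plus_def by blast
  have compl: "complementable N1" using d1 decomposition_commute unfolding complementable_def by blast
  obtain p where p: "is_projection p" "N1 = fixed_by p" using complementable_projection[OF compl] .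
  obtain e where e: "e * e = e" "M2 = fixed_by e" "N2 = fixed_by (1 - e)"
    using decomposition_idempotent[OF d2] .
  define f where "f = F 1"
  have Fx: "F x = f * x" for x using bounded_operator_eq_lmult[OF F] by (metis f_def lmult_def)
  have pr: "proj_along M2 N2 (F x) = e * (f * x)" for x
    using e by (simp add: proj_along_fixed_by lmult_def Fx)
  have bij: "bij_betw (\<lambda>x. e * (f * x)) M1 M2"
    and inv: "bounded_module_map M2 M1 (inv_into M1 (\<lambda>x. e * (f * x)))"
    using iso by (simp_all only: module_iso_def pr)
  from inv have "\<exists>K. \<forall>y\<in>M2. norm (inv_into M1 (\<lambda>x. e * (f * x)) y) \<le> K * norm y"
    unfolding bounded_module_map_def by (elim conjE)
  then obtain K where K: "\<forall>y\<in>M2. norm (inv_into M1 (\<lambda>x. e * (f * x)) y) \<le> K * norm y" ..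
  (* The summands 1 keep the constant positive even if K or e vanishes. *)
  have "norm x \<le> (\<bar>K\<bar> + 1) * (norm e + 1) * norm (F x)" if "x \<in> orth_compl N1" for x
  proof -
    obtain m n where mn: "x = m + n" "m \<in> M1" "n \<in> N1"
      using d1 unfolding decomposition_def by blast
    have "p * x = 0" using that p
      by (simp add: orth_compl_fixed_by mem_fixed_by_iff left_diff_distrib)
    moreover have "p * n = n" using mn(3) p(2) by (simp add: fixed_by_def)
    ultimately have "x = (1 - p) * m" using mn(1) by (simp add: algebra_simps add_eq_0_iff)
    then have "norm x \<le> norm m"
      using norm_projection_mult_le is_projection_one_minus p(1) by blast
    also have "m = inv_into M1 (\<lambda>x. e * (f * x)) (e * (f * m))"
      using inv_into_f_f[OF bij_betw_imp_inj_on[OF bij] mn(2)] by simp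
    also have "norm \<dots> \<le> K * norm (e * (f * m))"
      using bij mn(2) by (intro K[rule_format]) (auto simp: bij_betw_def)
    also have "e * (f * m) = e * F x"
      using N1[unfolded pr] mn by (simp add: Fx distrib_left)
    also have "K * norm (e * F x) \<le> (\<bar>K\<bar> + 1) * ((norm e + 1) * norm (F x))"
    proof (rule mult_mono)
      show "norm (e * F x) \<le> (norm e + 1) * norm (F x)"
        using norm_mult_ineq[of e "F x"] norm_ge_zero[of "F x"] unfolding distrib_right by linarith
    qed auto
    finally show ?thesis by (simp add: mult.assoc)
  qed
  moreover have pos: "(\<bar>K\<bar> + 1) * (norm e + 1) > 0"
    by (intro mult_pos_pos add_nonneg_pos) auto
  ultimately have "bounded_below_on (orth_compl N1) F"
    unfolding bounded_below_on_def
    by (intro exI[of _ "1 / ((\<bar>K\<bar> + 1) * (norm e + 1))"]) (simp add: pos_divide_le_eq mult.commute)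
  with compl q show ?thesis by blast
qed

text \<open>Relative to the range of \<open>r\<close>, the operator \<open>adj g * g\<close> is bounded below because
  \<open>norm (g * x)\<^sup>2 = norm (adj x * (adj g * g * x))\<close>; adding \<open>1 - r\<close> extends this to the whole
  algebra without losing selfadjointness.\<close>

lemma bounded_below_left_inverse:
  assumes r: "is_projection (r::'a::unital_cstar_algebra)" and gr: "g * r = g"
    and c: "c > 0" "\<And>x. r * x = x \<Longrightarrow> norm (g * x) \<ge> c * norm x"
  obtains w where "w * adj g * g = r" "r * w = w * r"
proof -
  define p where "p = 1 - r"
  define h where "h = adj g * g"
  have p: "is_projection p" using r by (simp add: p_def is_projection_one_minus)
  have rr: "r * r = r" "adj r = r" and pp: "p * p = p" "adj p = p"
    using r p by (auto simp: is_projection_def)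
  have rg: "r * adj g = adj g" using gr rr by (metis adj_mult)
  have h: "h * r = h" "r * h = h" "p * h = 0" "r * p = 0" "p * r = 0"
    using gr rg by (simp_all add: h_def p_def mult.assoc rr algebra_simps) (simp add: mult.assoc[symmetric] rg)+
  have hlow: "c\<^sup>2 * norm (r * x) \<le> norm (h * x)" for x
  proof (cases "r * x = 0")
    case False
    have hx: "h * (r * x) = h * x" by (simp add: mult.assoc[symmetric] h)
    have "(c * norm (r * x))\<^sup>2 \<le> (norm (g * (r * x)))\<^sup>2"
      using c(2)[of "r * x"] c(1) rr by (intro power_mono) (simp_all add: mult.assoc[symmetric])
    also have "\<dots> = norm (adj (r * x) * (h * x))"
      unfolding hx[symmetric] by (simp only: cstar_identity[symmetric] adj_mult[of g] h_def mult.assoc)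
    also have "\<dots> \<le> norm (r * x) * norm (h * x)"
      using norm_mult_ineq[of "adj (r * x)" "h * x"] by (simp add: norm_adj)
    finally have "norm (r * x) * (c\<^sup>2 * norm (r * x)) \<le> norm (r * x) * norm (h * x)"
      by (simp add: power2_eq_square mult_ac)
    then show ?thesis using False by simp
  qed simp
  define d where "d = 1 / (1 / c\<^sup>2 + 1)"
  have dpos: "1 / c\<^sup>2 + 1 > 0" using c(1) by (simp add: add_pos_pos)
  have "d * norm x \<le> norm ((h + p) * x)" for x
  proof -
    have "r * ((h + p) * x) = h * x" "p * ((h + p) * x) = p * x"
      by (simp_all add: mult.assoc[symmetric] distrib_left h pp)
    then have le: "norm (h * x) \<le> norm ((h + p) * x)" "norm (p * x) \<le> norm ((h + p) * x)"
      using norm_projection_mult_le[OF r, of "(h + p) * x"]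
        norm_projection_mult_le[OF p, of "(h + p) * x"] by simp_all
    have "norm x \<le> norm (r * x) + norm (p * x)"
      using norm_triangle_ineq[of "r * x" "p * x"] by (simp add: p_def algebra_simps)
    also have "norm (r * x) \<le> norm (h * x) / c\<^sup>2"
      using hlow[of x] c(1) by (simp add: pos_le_divide_eq mult.commute)
    also have "norm (h * x) / c\<^sup>2 \<le> norm ((h + p) * x) / c\<^sup>2"
      using le(1) by (intro divide_right_mono) simp_all
    finally have "norm x \<le> (1 / c\<^sup>2 + 1) * norm ((h + p) * x)"
      using le(2) by (simp add: algebra_simps)
    then show ?thesis using dpos by (simp add: d_def pos_divide_le_eq mult.commute)
  qed
  moreover have "d > 0" using dpos by (simp add: d_def)
  moreover have "adj (h + p) = h + p" by (simp add: h_def adj_add adj_mult adj_adj pp)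
  ultimately have "has_inverse (h + p)" by (intro selfadjoint_bounded_below_has_inverse)
  then obtain w where w: "(h + p) * w = 1" "w * (h + p) = 1" unfolding has_inverse_def by blast
  have hp: "(h + p) * r = h" "r * (h + p) = h" by (simp_all add: distrib_right distrib_left h)
  have wh: "w * h = r" by (metis hp(1) w(2) mult.assoc mult_1_left)
  have hw: "h * w = r" by (metis hp(2) w(1) mult.assoc mult_1_right)
  show thesis
  proof
    show "w * adj g * g = r" using wh by (simp add: h_def mult.assoc)
    have "w * r = w * (h * w)" by (simp add: hw)
    also have "\<dots> = r * w" by (simp add: mult.assoc[symmetric] wh)
    finally show "r * w = w * r" by simp
  qed
qed

text \<open>Here \<open>u = w * adj g\<close> inverts \<open>f\<close> on the range of \<open>r = 1 - p\<close>, so \<open>g * u\<close> is an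
  idempotent onto the image of that range. Shearing the range of \<open>p\<close> by \<open>1 - u * f\<close> moves it
  to a complement on which \<open>f\<close> has no component in this image; the corresponding idempotent
  \<open>e\<close> is a multiple of \<open>p\<close>, so its range projection lies in the ideal.\<close>

lemma bounded_below_imp_MKPhi_plus:
  fixes I :: "'a::unital_cstar_algebra set"
  assumes I: "selfadjoint_ideal I" and F: "F \<in> bounded_operators"
    and M: "complementable M" "bounded_below_on (orth_compl M) F" "orth_proj M \<in> lmult ` I"
  shows "F \<in> MKPhi_plus I"
proof -
  obtain p where p: "is_projection p" "M = fixed_by p" using complementable_projection[OF M(1)] .
  have pI: "p \<in> I" using M(3) p by (simp add: orth_proj_in_lmult_iff)
  define f where "f = F 1"
  have Fx: "F x = f * x" for x using bounded_operator_eq_lmult[OF F] by (metis f_def lmult_def)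
  define r where "r = 1 - p"
  define g where "g = f * r"
  have r: "is_projection r" using p by (simp add: r_def is_projection_one_minus)
  have rr: "r * r = r" "adj r = r" and pp: "p * p = p" 
    using r p by (auto simp: is_projection_def)
  have gr: "g * r = g" by (simp add: g_def mult.assoc rr)
  obtain c where "c > 0" "\<And>x. r * x = x \<Longrightarrow> norm (F x) \<ge> c * norm x"
    using M(2) p by (auto simp: bounded_below_on_def orth_compl_fixed_by mem_fixed_by_iff r_def)
  moreover have gx: "g * x = f * x" if "r * x = x" for x
    using that by (simp add: g_def mult.assoc)
  ultimately have c: "c > 0" "\<And>x. r * x = x \<Longrightarrow> norm (g * x) \<ge> c * norm x"
    by (simp_all add: Fx)
  obtain w where w: "w * adj g * g = r" "r * w = w * r"
    using bounded_below_left_inverse[OF r gr c] .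
  define u where "u = w * adj g"
  have ug: "u * g = r" using w by (simp add: u_def)
  have "r * adj g = adj g" using gr rr by (metis adj_mult)
  then have ru: "r * u = u" by (simp add: u_def mult.assoc[symmetric] w(2)) (simp add: mult.assoc)
  have fu: "f * u = g * u" using ru by (simp add: g_def mult.assoc)
  define e where "e = p - u * f * p"
  define e2 where "e2 = g * u"
  have e2: "e2 * e2 = e2" by (metis e2_def gr mult.assoc ug)
  have e2g: "e2 * g = g" by (simp add: e2_def mult.assoc ug gr)
  have pu: "p * u = 0" using ru by (simp add: r_def algebra_simps)
  have pe: "p * e = p" by (simp add: e_def right_diff_distrib pp mult.assoc[symmetric] pu)
  have ep: "e * p = e" by (simp add: e_def left_diff_distrib mult.assoc pp)
  have ee: "e * e = e" by (metis ep pe mult.assoc)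
  have M1: "fixed_by (1 - e) = fixed_by r"
  proof (rule fixed_by_eqI)
    show "(1 - e) * r = r" by (simp add: r_def algebra_simps ep)
    show "r * (1 - e) = 1 - e" by (simp add: r_def algebra_simps pe)
  qed
  have e2fe: "e2 * (f * e) = 0"
  proof -
    have "f * e = f * p - e2 * f * p" by (simp add: e_def right_diff_distrib mult.assoc[symmetric] fu e2_def)
    then show ?thesis by (simp add: right_diff_distrib mult.assoc[symmetric] e2)
  qed
  have d1: "decomposition (fixed_by r) (fixed_by e)"
    using decomposition_fixed_by[OF ee] M1 decomposition_commute by metis
  have d2: "decomposition (fixed_by e2) (fixed_by (1 - e2))"
    by (rule decomposition_fixed_by[OF e2])
  have pr: "proj_along (fixed_by e2) (fixed_by (1 - e2)) x = e2 * x" for x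
    by (simp add: proj_along_fixed_by[OF e2] lmult_def)
  have pr': "proj_along (fixed_by (1 - e2)) (fixed_by e2) x = (1 - e2) * x" for x
    using proj_along_fixed_by[of "1 - e2"] e2 by (simp add: algebra_simps lmult_def)
  have N1: "\<forall>x\<in>fixed_by e. proj_along (fixed_by e2) (fixed_by (1 - e2)) (F x) = 0"
  proof
    fix x assume "x \<in> fixed_by e"
    then have "e2 * (f * x) = e2 * (f * e) * x" by (simp add: mem_fixed_by_iff mult.assoc)
    then show "proj_along (fixed_by e2) (fixed_by (1 - e2)) (F x) = 0"
      by (simp only: pr Fx e2fe mult_zero_left)
  qed
  have e2f: "e2 * (f * x) = g * x" if "r * x = x" for x
    by (simp only: gx[OF that, symmetric] mult.assoc[symmetric] e2g)
  have M1': "\<forall>x\<in>fixed_by r. proj_along (fixed_by (1 - e2)) (fixed_by e2) (F x) = 0"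
    by (simp add: pr' Fx mem_fixed_by_iff left_diff_distrib e2f gx)
  have iso: "module_iso (fixed_by r) (fixed_by e2)
      (\<lambda>x. proj_along (fixed_by e2) (fixed_by (1 - e2)) (F x))"
  proof (rule module_iso_lmult[where a = g and b = u])
    show "u * y \<in> fixed_by r" for y
      by (simp add: fixed_by_def mult.assoc[symmetric] ru)
    show "g * x \<in> fixed_by e2" for x
      by (simp add: fixed_by_def mult.assoc[symmetric] e2g)
    show "u * (g * x) = x" if "x \<in> fixed_by r" for x
      using that by (simp add: fixed_by_def mult.assoc[symmetric] ug)
    show "g * (u * y) = y" if "y \<in> fixed_by e2" for y
      using that by (simp add: fixed_by_def e2_def mult.assoc)
  qed (simp_all add: pr Fx mem_fixed_by_iff e2f closed_submodule_fixed_by)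
  obtain b where b: "is_projection (e * b)" "(e * b) * e = e"
    using idempotent_range_projection[OF ee] .
  have "fixed_by e = fixed_by (e * b)"
    by (rule fixed_by_eqI) (simp_all add: b(2) mult.assoc[symmetric] ee)
  moreover have "e * b = (1 - u * f) * p * b" by (simp add: e_def left_diff_distrib)
  then have "e * b \<in> I" using I pI by (auto simp: selfadjoint_ideal_def)
  ultimately have "orth_proj (fixed_by e) \<in> lmult ` I"
    using b(1) by (simp add: orth_proj_in_lmult_iff)
  with F d1 d2 N1 M1' iso show ?thesis unfolding MKPhi_plus_def by blast
qed

theorem lemma3p4:
  fixes I :: "'a::unital_cstar_algebra set" and F :: "'a \<Rightarrow> 'a"
  assumes "finite_type_ideal I"
    and "F \<in> bounded_operators"
  shows "F \<in> MKPhi_plus I \<longleftrightarrow>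
    (\<exists>M. complementable M \<and> bounded_below_on (orth_compl M) F \<and> orth_proj M \<in> lmult ` I)"
  using MKPhi_plus_imp_bounded_below bounded_below_imp_MKPhi_plus assms
  unfolding finite_type_ideal_def by blast

end
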